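(* For any integers $n_1,n_2$ such that $\frac{n_1-1}{2}\ge\left\lfloor\frac{n_2}{2}\right\rfloor\ge 2$, $\dim(P_{n_1}\boxtimes C_{n_2})\le n_1$.
   Context: $P_n$ and $C_n$ are the path and cycle of order $n$. A set $S\subseteq V(G)$ of a connected graph $G$ is a metric generator if for every two distinct vertices $x,y$ there is $s\in S$ with $d_G(s,x)\ne d_G(s,y)$ (shortest-path distance); $\dim(G)$ is the minimum cardinality of a metric generator. The strong product $G\boxtimes H$ has vertex set $V(G)\times V(H)$, with $(a,b)$ and $(c,d)$ adjacent iff ($a=c$ and $bd\in E(H)$) or ($b=d$ and $ac\in E(G)$) or ($ac\in E(G)$ and $bd\in E(H)$). *)

theory Defs
  imports "Graph_Theory.Graph_Theory"
begin

text \<open>A simple graph is a \<^locale>\<open>pair_graph\<close>: an undirected edge \<open>uv\<close> is represented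
  by the two arcs \<open>(u, v)\<close> and \<open>(v, u)\<close>.\<close>

definition path_graph :: "nat \<Rightarrow> nat pair_pre_digraph" where
  "path_graph n = \<lparr> pverts = {..<n},
     parcs = {(i, j). i < n \<and> j < n \<and> (j = Suc i \<or> i = Suc j)} \<rparr>"

text \<open>Intended for \<open>n \<ge> 3\<close>; the condition \<open>i \<noteq> j\<close> excludes a loop only when \<open>n = 1\<close>.\<close>

definition cycle_graph :: "nat \<Rightarrow> nat pair_pre_digraph" where
  "cycle_graph n = \<lparr> pverts = {..<n},
     parcs = {(i, j). i < n \<and> j < n \<and> i \<noteq> j \<and> (j = Suc i mod n \<or> i = Suc j mod n)} \<rparr>"

definition strong_product ::
    "'a pair_pre_digraph \<Rightarrow> 'b pair_pre_digraph \<Rightarrow> ('a \<times> 'b) pair_pre_digraph"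
    (infixl \<open>\<boxtimes>\<close> 70) where
  "G \<boxtimes> H = \<lparr> pverts = pverts G \<times> pverts H,
     parcs = {((a, b), (c, d)).
       a \<in> pverts G \<and> c \<in> pverts G \<and> b \<in> pverts H \<and> d \<in> pverts H \<and>
       (a = c \<and> (b, d) \<in> parcs H \<or>
        b = d \<and> (a, c) \<in> parcs G \<or>
        (a, c) \<in> parcs G \<and> (b, d) \<in> parcs H)} \<rparr>"

text \<open>Every arc has weight 1, so the cost of a walk is its length; the distance is
  \<open>\<infinity>\<close> between vertices in different components.\<close>

definition graph_dist :: "'a pair_pre_digraph \<Rightarrow> 'a \<Rightarrow> 'a \<Rightarrow> ereal" where
  "graph_dist G u v = wf_digraph.\<mu> (with_proj G) (\<lambda>_. 1) u v"

definition metric_generator :: "'a pair_pre_digraph \<Rightarrow> 'a set \<Rightarrow> bool" where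
  "metric_generator G S \<longleftrightarrow> S \<subseteq> pverts G \<and>
     (\<forall>x \<in> pverts G. \<forall>y \<in> pverts G. x \<noteq> y \<longrightarrow>
        (\<exists>s \<in> S. graph_dist G s x \<noteq> graph_dist G s y))"

text \<open>Finiteness of \<open>S\<close> is required because \<^const>\<open>card\<close> is 0 on infinite sets.
  The minimum is attained on every finite simple graph (\<open>metric_dim_attained\<close> below).\<close>

definition metric_dim :: "'a pair_pre_digraph \<Rightarrow> nat" where
  "metric_dim G = (LEAST k. \<exists>S. finite S \<and> metric_generator G S \<and> card S = k)"

lemma pair_graph_path_graph: "pair_graph (path_graph n)"
  by unfold_locales
    (auto simp: path_graph_def symmetric_def sym_def intro: finite_subset[of _ "{..<n} \<times> {..<n}"])

lemma pair_graph_cycle_graph: "pair_graph (cycle_graph n)"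
  by unfold_locales
    (auto simp: cycle_graph_def symmetric_def sym_def intro: finite_subset[of _ "{..<n} \<times> {..<n}"])

lemma pair_graph_strong_product:
  assumes "pair_graph G" and "pair_graph H"
  shows "pair_graph (G \<boxtimes> H)"
proof -
  interpret G: pair_graph G by fact
  interpret H: pair_graph H by fact
  have symG: "(b, a) \<in> parcs G" if "(a, b) \<in> parcs G" for a b
    using G.pair_sym_arcs that by (auto simp: symmetric_def sym_def)
  have symH: "(b, a) \<in> parcs H" if "(a, b) \<in> parcs H" for a b
    using H.pair_sym_arcs that by (auto simp: symmetric_def sym_def)
  have fin: "finite (pverts (G \<boxtimes> H))"
    using G.pair_finite_verts H.pair_finite_verts by (simp add: strong_product_def)
  have sub: "parcs (G \<boxtimes> H) \<subseteq> pverts (G \<boxtimes> H) \<times> pverts (G \<boxtimes> H)"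
    by (auto simp: strong_product_def)
  show ?thesis
  proof unfold_locales
    show "finite (parcs (G \<boxtimes> H))"
      using sub fin by (meson finite_SigmaI finite_subset)
    show "symmetric (with_proj (G \<boxtimes> H))"
      by (auto simp: strong_product_def symmetric_def sym_def intro: symG symH)
    show "fst e \<noteq> snd e" if "e \<in> parcs (G \<boxtimes> H)" for e
      using that G.pair_no_loops H.pair_no_loops by (fastforce simp: strong_product_def)
  qed (use fin sub in auto)
qed

lemma connected_path_strong_product_cycle:
  assumes "0 < m" and "0 < n"
  shows "Digraph_Component.connected (with_proj (path_graph m \<boxtimes> cycle_graph n))"
proof -
  let ?G = "path_graph m \<boxtimes> cycle_graph n"
  interpret pair_graph ?G
    by (intro pair_graph_strong_product pair_graph_path_graph pair_graph_cycle_graph)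
  have V: "pverts ?G = {..<m} \<times> {..<n}"
    by (simp add: strong_product_def path_graph_def cycle_graph_def)
  have to0: "reachable (with_proj ?G) (a, b) (0, 0)" if "a < m" "b < n" for a b
    using that
  proof (induction "a + b" arbitrary: a b)
    case 0
    then show ?case using V by auto
  next
    case (Suc k)
    show ?case
    proof (cases a)
      case (Suc a')
      have "((a, b), (a', b)) \<in> parcs ?G"
        using Suc \<open>a < m\<close> \<open>b < n\<close>
        by (auto simp: strong_product_def path_graph_def cycle_graph_def)
      moreover have "reachable (with_proj ?G) (a', b) (0, 0)"
        using Suc.hyps(1)[of a' b] Suc.hyps(2) Suc.prems Suc by simp
      ultimately show ?thesis by (metis adj_reachable_trans)
    next
      case 0
      then obtain b' where b: "b = Suc b'" using Suc.hyps(2) by (cases b) auto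
      have "((a, b), (a, b')) \<in> parcs ?G"
        using b \<open>a < m\<close> \<open>b < n\<close>
        by (auto simp: strong_product_def path_graph_def cycle_graph_def)
      moreover have "reachable (with_proj ?G) (a, b') (0, 0)"
        using Suc.hyps(1)[of a b'] Suc.hyps(2) Suc.prems b by simp
      ultimately show ?thesis by (metis adj_reachable_trans)
    qed
  qed
  have "strongly_connected (with_proj ?G)"
  proof
    show "verts (with_proj ?G) \<noteq> {}" using assms V by auto
  next
    fix u v assume "u \<in> verts (with_proj ?G)" "v \<in> verts (with_proj ?G)"
    then have "reachable (with_proj ?G) u (0, 0)" "reachable (with_proj ?G) v (0, 0)"
      using to0 V by auto
    then show "reachable (with_proj ?G) u v"
      using pair_sym_arcs symmetric_reachable reachable_trans by metis
  qed
  then show ?thesis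
    unfolding Digraph_Component.connected_def strongly_connected_def
    by (auto intro: reachable_mk_symmetricI)
qed

lemma metric_dim_attained:
  assumes "pair_graph G"
  shows "\<exists>S. finite S \<and> metric_generator G S \<and> card S = metric_dim G"
proof -
  interpret pair_graph G by fact
  have cost: "awalk_cost (\<lambda>_. 1) p = real (length p)" for p
    by (simp add: awalk_cost_def sum_list_triv)
  have self: "graph_dist G u u \<le> 0" if "u \<in> pverts G" for u
    using min_cost_le_walk_cost[of u "[]" u "\<lambda>_. 1"] that
    by (simp add: graph_dist_def awalk_Nil_iff zero_ereal_def)
  have other: "1 \<le> graph_dist G u v" if "u \<noteq> v" for u v
    unfolding graph_dist_def \<mu>_def
  proof (rule INF_greatest)
    fix p assume "p \<in> {p. awalk u p v}"
    with \<open>u \<noteq> v\<close> have "p \<noteq> []" by (auto simp: awalk_Nil_iff)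
    then show "1 \<le> ereal (awalk_cost (\<lambda>_. 1) p)"
      by (cases p) (simp_all add: cost one_ereal_def)
  qed
  have "graph_dist G x x \<noteq> graph_dist G x y" if "x \<in> pverts G" "x \<noteq> y" for x y
  proof
    assume "graph_dist G x x = graph_dist G x y"
    with self[OF that(1)] other[OF that(2)] have "(1::ereal) \<le> 0" by (metis order_trans)
    then show False by simp
  qed
  then have "metric_generator G (pverts G)"
    unfolding metric_generator_def by blast
  then have "\<exists>k S. finite S \<and> metric_generator G S \<and> card S = k"
    using pair_finite_verts by blast
  then show ?thesis
    unfolding metric_dim_def by (rule LeastI_ex)
qed

end

theory Submission
  imports Defs
begin

text \<open>Distances in a strong product are maxima of distances in the factors. With one landmark
  \<open>(i, i mod 2)\<close> in each row, two vertices of the same row are separated by the landmark of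
  that row, which identifies a vertex up to a reflection of the cycle, together with that of a
  neighbouring row, whose different second coordinate breaks the reflection. Write \<open>h\<close> for
  \<open>n2 div 2\<close>, the largest distance in the cycle. Given rows \<open>a < c\<close>,
  the landmark of row \<open>0\<close> separates them if \<open>c > h\<close>, and that of row \<open>n1 - 1\<close> separates them if
  \<open>n1 - 1 - a > h\<close>; as \<open>n1 - 1 \<ge> 2 * h\<close>, one of the two cases always holds.\<close>

section \<open>Distances from local certificates\<close>

text \<open>Certifies \<open>f\<close> as the distance to \<open>v\<close> by conditions on single
  vertices and arcs, so that distances in the product and in its factors can be determined without
  handling walks.\<close>

definition is_dist_to :: "'a pair_pre_digraph \<Rightarrow> 'a \<Rightarrow> ('a \<Rightarrow> nat) \<Rightarrow> bool" where
  "is_dist_to G v f \<longleftrightarrow> (\<forall>u \<in> pverts G. f u = 0 \<longleftrightarrow> u = v) \<and>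
     (\<forall>(u, w) \<in> parcs G. f u \<le> Suc (f w)) \<and>
     (\<forall>u \<in> pverts G. u \<noteq> v \<longrightarrow> (\<exists>w. (u, w) \<in> parcs G \<and> f u = Suc (f w)))"

text \<open>Along an arc \<open>f\<close> drops by at most 1, so a walk from \<open>u\<close> to
  \<open>v\<close> has length at least \<open>f u\<close>. Following arcs on which it drops by
  exactly 1 builds a walk of that length.\<close>

lemma graph_dist_eq_is_dist_to:
  assumes "pair_graph G" "is_dist_to G v f" "u \<in> pverts G" "v \<in> pverts G"
  shows "graph_dist G u v = ereal (real (f u))"
proof -
  interpret pair_graph G by fact
  have cost: "awalk_cost (\<lambda>_. 1) p = real (length p)" for p
    by (simp add: awalk_cost_def sum_list_triv)
  have lower: "f u \<le> length p" if "awalk u p v" for u p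
    using that
  proof (induction p arbitrary: u)
    case Nil
    then show ?case using assms(2) by (auto simp: awalk_Nil_iff is_dist_to_def)
  next
    case (Cons e p)
    then have "e \<in> parcs G" "fst e = u" "awalk (snd e) p v"
      by (auto simp: awalk_Cons_iff)
    with Cons.IH[of "snd e"] assms(2) show ?case
      by (cases e) (fastforce simp: is_dist_to_def)
  qed
  have upper: "\<exists>p. awalk u p v \<and> length p = f u" if "u \<in> pverts G" for u
    using that
  proof (induction "f u" arbitrary: u)
    case 0
    then have "u = v" using assms(2) by (auto simp: is_dist_to_def)
    then show ?case using 0 by (intro exI[of _ "[]"]) (auto simp: awalk_Nil_iff)
  next
    case (Suc k)
    then have "u \<noteq> v" using assms(2) by (auto simp: is_dist_to_def)
    then obtain w where w: "(u, w) \<in> parcs G" "f u = Suc (f w)"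
      using assms(2) Suc.prems by (auto simp: is_dist_to_def)
    then have "w \<in> pverts G" using in_arcsD2 by blast
    then obtain p where "awalk w p v" "length p = f w"
      using Suc.hyps w by auto
    then show ?case
      using w by (intro exI[of _ "(u, w) # p"]) (auto simp: awalk_Cons_iff)
  qed
  obtain p where "awalk u p v" "length p = f u" using upper assms(3) by blast
  then have "graph_dist G u v \<le> ereal (real (f u))"
    using min_cost_le_walk_cost[of u p v "\<lambda>_. 1"] by (simp add: graph_dist_def cost)
  moreover have "ereal (real (f u)) \<le> graph_dist G u v"
    unfolding graph_dist_def \<mu>_def
    by (rule INF_greatest) (use lower in \<open>auto simp: cost\<close>)
  ultimately show ?thesis by (rule antisym)
qed

text \<open>An arc of the strong product may move both coordinates at once, so both factor distances
  can decrease in the same step and the larger one governs.\<close>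

lemma is_dist_to_strong_product:
  assumes G: "is_dist_to G c f" and H: "is_dist_to H d g"
    and "pair_graph G" "pair_graph H" and "c \<in> pverts G" "d \<in> pverts H"
  shows "is_dist_to (G \<boxtimes> H) (c, d) (\<lambda>(a, b). max (f a) (g b))"
proof -
  interpret G: pair_graph G by fact
  interpret H: pair_graph H by fact
  have f0: "f a = 0 \<longleftrightarrow> a = c" if "a \<in> pverts G" for a
    using G that by (auto simp: is_dist_to_def)
  have g0: "g b = 0 \<longleftrightarrow> b = d" if "b \<in> pverts H" for b
    using H that by (auto simp: is_dist_to_def)
  have f1: "f a \<le> Suc (f a')" if "(a, a') \<in> parcs G" for a a'
    using G that by (auto simp: is_dist_to_def)
  have g1: "g b \<le> Suc (g b')" if "(b, b') \<in> parcs H" for b b'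
    using H that by (auto simp: is_dist_to_def)
  have step: "\<exists>w. ((a, b), w) \<in> parcs (G \<boxtimes> H) \<and>
      max (f a) (g b) = Suc (case w of (a', b') \<Rightarrow> max (f a') (g b'))"
    if "(a, b) \<in> pverts (G \<boxtimes> H)" and ne: "(a, b) \<noteq> (c, d)" for a b
  proof -
    have ab: "a \<in> pverts G" "b \<in> pverts H"
      using that by (simp_all add: strong_product_def)
    have a: "\<exists>a'. a' \<in> pverts G \<and> (a, a') \<in> parcs G \<and> f a = Suc (f a')" if "a \<noteq> c"
      using G that ab G.in_arcsD2 by (fastforce simp: is_dist_to_def)
    have b: "\<exists>b'. b' \<in> pverts H \<and> (b, b') \<in> parcs H \<and> g b = Suc (g b')" if "b \<noteq> d"
      using H that ab H.in_arcsD2 by (fastforce simp: is_dist_to_def)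
    \<comment> \<open>A coordinate that has reached its target stays there with value 0, so the
      maximum is the other value and drops with it.\<close>
    consider "a = c" "b \<noteq> d" | "a \<noteq> c" "b = d" | "a \<noteq> c" "b \<noteq> d" using ne by auto
    then show ?thesis
    proof cases
      case 1
      then obtain b' where "b' \<in> pverts H" "(b, b') \<in> parcs H" "g b = Suc (g b')" using b by auto
      then show ?thesis
        using 1 ab f0[of c] by (intro exI[of _ "(c, b')"]) (auto simp: strong_product_def)
    next
      case 2
      then obtain a' where "a' \<in> pverts G" "(a, a') \<in> parcs G" "f a = Suc (f a')" using a by auto
      then show ?thesis
        using 2 ab g0[of d] by (intro exI[of _ "(a', d)"]) (auto simp: strong_product_def)
    next
      case 3
      then obtain a' b' where "a' \<in> pverts G" "(a, a') \<in> parcs G" "f a = Suc (f a')"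
        "b' \<in> pverts H" "(b, b') \<in> parcs H" "g b = Suc (g b')" using a b by blast
      then show ?thesis
        using ab by (intro exI[of _ "(a', b')"]) (auto simp: strong_product_def)
    qed
  qed
  have zero: "max (f a) (g b) = 0 \<longleftrightarrow> (a, b) = (c, d)" if "(a, b) \<in> pverts (G \<boxtimes> H)" for a b
    using f0[of a] g0[of b] that
    by (simp add: strong_product_def)
  have arc: "max (f a) (g b) \<le> Suc (max (f a') (g b'))"
    if "((a, b), (a', b')) \<in> parcs (G \<boxtimes> H)" for a b a' b'
    using that f1[of a a'] g1[of b b'] by (auto simp: strong_product_def)
  show ?thesis
    unfolding is_dist_to_def Ball_def split_paired_All prod.case
    using zero arc step by fast
qed

section \<open>Distances in paths, cycles and their strong product\<close>

definition path_dist :: "nat \<Rightarrow> nat \<Rightarrow> nat" where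
  "path_dist i j = (if i \<le> j then j - i else i - j)"

definition cycle_dist :: "nat \<Rightarrow> nat \<Rightarrow> nat \<Rightarrow> nat" where
  "cycle_dist n i j = min (path_dist i j) (n - path_dist i j)"

lemma is_dist_to_path_graph:
  assumes "j < n"
  shows "is_dist_to (path_graph n) j (\<lambda>i. path_dist i j)"
proof -
  have "\<exists>k. (i, k) \<in> parcs (path_graph n) \<and> path_dist i j = Suc (path_dist k j)"
    if "i < n" "i \<noteq> j" for i
    using that assms
    by (intro exI[of _ "if i < j then Suc i else i - 1"])
      (auto simp: path_graph_def path_dist_def)
  then show ?thesis
    by (auto simp: is_dist_to_def path_graph_def path_dist_def)
qed

lemma parcs_cycle_graph:
  "(i, j) \<in> parcs (cycle_graph n) \<longleftrightarrow> i < n \<and> j < n \<and> i \<noteq> j \<and>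
    (j = Suc i \<or> i = Suc j \<or> Suc i = n \<and> j = 0 \<or> Suc j = n \<and> i = 0)"
  by (auto simp: cycle_graph_def mod_Suc)

lemma is_dist_to_cycle_graph:
  assumes "j < n"
  shows "is_dist_to (cycle_graph n) j (\<lambda>i. cycle_dist n i j)"
proof -
  have "\<exists>k. (i, k) \<in> parcs (cycle_graph n) \<and> cycle_dist n i j = Suc (cycle_dist n k j)"
    if i: "i < n" "i \<noteq> j" for i
  proof -
    let ?up = "if Suc i = n then 0 else Suc i"
    let ?down = "if i = 0 then n - 1 else i - 1"
    have "(i, ?up) \<in> parcs (cycle_graph n)" "(i, ?down) \<in> parcs (cycle_graph n)"
      using i assms by (auto simp: parcs_cycle_graph)
    moreover have "cycle_dist n i j = Suc (cycle_dist n ?up j) \<or>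
        cycle_dist n i j = Suc (cycle_dist n ?down j)"
    proof -
      \<comment> \<open>The descending step leads to \<open>j\<close> along the shorter way round;
        on a tie, the way that does not wrap is taken.\<close>
      consider "i < j" "2 * (j - i) \<le> n" | "i < j" "\<not> 2 * (j - i) \<le> n"
        | "j < i" "2 * (i - j) \<le> n" | "j < i" "\<not> 2 * (i - j) \<le> n"
        using i by linarith
      then show ?thesis
      proof cases
        case 1
        then have "cycle_dist n i j = Suc (cycle_dist n ?up j)"
          using i assms by (auto simp: cycle_dist_def path_dist_def min_def)
        then show ?thesis ..
      next
        case 2
        then have "cycle_dist n i j = Suc (cycle_dist n ?down j)"
          using i assms by (cases i) (auto simp: cycle_dist_def path_dist_def min_def)
        then show ?thesis ..
      next
        case 3
        then have "cycle_dist n i j = Suc (cycle_dist n ?down j)"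
          using i assms by (cases i) (auto simp: cycle_dist_def path_dist_def min_def)
        then show ?thesis ..
      next
        case 4
        then have "cycle_dist n i j = Suc (cycle_dist n ?up j)"
          using i assms by (auto simp: cycle_dist_def path_dist_def min_def)
        then show ?thesis ..
      qed
    qed
    ultimately show ?thesis by blast
  qed
  moreover have "cycle_dist n i j \<le> Suc (cycle_dist n k j)"
    if "(i, k) \<in> parcs (cycle_graph n)" for i k
  proof -
    \<comment> \<open>The second alternative is the wrap-around arc between \<open>n - 1\<close> and
      \<open>0\<close>: there the two path distances are \<open>n - 1 - j\<close> and
      \<open>j\<close>.\<close>
    have "path_dist i j \<le> Suc (path_dist k j) \<and> path_dist k j \<le> Suc (path_dist i j) \<or>
        Suc (path_dist i j + path_dist k j) = n"
      using that assms by (auto simp: parcs_cycle_graph path_dist_def)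
    moreover have "path_dist i j < n" "path_dist k j < n"
      using that assms by (auto simp: parcs_cycle_graph path_dist_def)
    ultimately show ?thesis by (auto simp: cycle_dist_def min_def)
  qed
  moreover have "cycle_dist n i j = 0 \<longleftrightarrow> i = j" if "i < n" for i
    using that assms by (auto simp: cycle_dist_def path_dist_def min_def)
  ultimately show ?thesis
    by (auto simp: is_dist_to_def) (auto simp: cycle_graph_def)
qed

lemma graph_dist_path_strong_product_cycle:
  assumes "a < m" "b < n" "c < m" "d < n"
  shows "graph_dist (path_graph m \<boxtimes> cycle_graph n) (a, b) (c, d) =
    ereal (real (max (path_dist a c) (cycle_dist n b d)))"
proof -
  have V: "pverts (path_graph m) = {..<m}" "pverts (cycle_graph n) = {..<n}"
    by (simp_all add: path_graph_def cycle_graph_def)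
  show ?thesis
    using graph_dist_eq_is_dist_to[OF pair_graph_strong_product is_dist_to_strong_product,
        of "path_graph m" "cycle_graph n" c "\<lambda>a. path_dist a c" d "\<lambda>b. cycle_dist n b d" "(a, b)"]
      assms pair_graph_path_graph[of m] pair_graph_cycle_graph[of n]
      is_dist_to_path_graph is_dist_to_cycle_graph V
    by (auto simp: strong_product_def)
qed

section \<open>Separating two vertices of the same row\<close>

lemma cycle_dist_le: "cycle_dist n i j \<le> n div 2"
  by (auto simp: cycle_dist_def min_def)

text \<open>Cycle distance to a landmark determines the path distance up to the replacement of
  \<open>p\<close> by \<open>n - p\<close>, which swaps the two ways round.\<close>

lemma min_minus_eqD:
  fixes p q n :: nat
  assumes "min p (n - p) = min q (n - q)" "p < n" "q < n"
  shows "p = q \<or> p + q = n"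
  using assms by (auto simp: min_def split: if_splits)

text \<open>Truncation at 1 merges a landmark with its two neighbours; the last alternative is that
  both arguments lie in this merged class.\<close>

lemma max_1_min_minus_eqD:
  fixes p q n :: nat
  assumes "max 1 (min p (n - p)) = max 1 (min q (n - q))" "p < n" "q < n"
  shows "p = q \<or> p + q = n \<or> (p \<le> 1 \<or> n \<le> Suc p) \<and> (q \<le> 1 \<or> n \<le> Suc q)"
  using assms by (auto simp: min_def max_def split: if_splits)

lemma path_dist_0: "path_dist 0 b = b"
  by (simp add: path_dist_def)

text \<open>Truncating the second distance at 1 accounts for its landmark lying in a neighbouring row.\<close>

lemma cycle_dist_resolves:
  assumes "4 \<le> n" "b < n" "d < n" "{i, j} = {0, 1}"
    and "cycle_dist n i b = cycle_dist n i d"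
    and "max 1 (cycle_dist n j b) = max 1 (cycle_dist n j d)"
  shows "b = d"
proof -
  \<comment> \<open>The hypotheses on \<open>b\<close> and \<open>d\<close> are symmetric, so
    excluding one strict order excludes both.\<close>
  have "\<not> b < d"
    if bd: "b < n" "d < n"
      and i: "cycle_dist n i b = cycle_dist n i d"
      and j: "max 1 (cycle_dist n j b) = max 1 (cycle_dist n j d)" for b d
  proof
    assume "b < d"
    note eqs = i[unfolded cycle_dist_def] j[unfolded cycle_dist_def]
    have d1: "path_dist 1 d = d - 1" "path_dist 1 d < n"
      using bd \<open>b < d\<close> by (auto simp: path_dist_def)
    have b1: "path_dist 1 b < n" "b = 0 \<and> path_dist 1 b = 1 \<or> 0 < b \<and> path_dist 1 b = b - 1"
      using bd assms(1) by (auto simp: path_dist_def)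
    consider "i = 0" "j = 1" | "i = 1" "j = 0"
      using assms(4) by (auto simp: doubleton_eq_iff)
    then show False
    proof cases
      case 1
      \<comment> \<open>Vertices equidistant from 0 are mirror images in 0. Their path distances to
        1 then add up to \<open>n - 2\<close>, not \<open>n\<close>, and the larger vertex is more
        than one step away from 1 because \<open>n\<close> is at least 4.\<close>
      then have "b + d = n"
        using min_minus_eqD[OF eqs(1)] bd \<open>b < d\<close> by (simp add: path_dist_0)
      then have "0 < b" "2 * b < n" "d = n - b"
        using bd \<open>b < d\<close> by linarith+
      then show False
        using max_1_min_minus_eqD[OF eqs(2)] 1 b1 d1 assms(1) by auto
    next
      case 2
      then have "path_dist 1 b = path_dist 1 d \<or> path_dist 1 b + path_dist 1 d = n"
        using min_minus_eqD[OF eqs(1)] b1 d1 by simp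
      \<comment> \<open>The reflection in 1 sends \<open>b\<close> to \<open>2 - b\<close> modulo
        \<open>n\<close>; the pair 0 and 2 is listed apart because only \<open>b = 0\<close> lies
        below the landmark. This reflection is incompatible with the one in 0, which sends
        \<open>b\<close> to \<open>- b\<close>.\<close>
      then have "b = 0 \<and> d = 2 \<or> b + d = n + 2"
        using b1(2) d1 bd \<open>b < d\<close> by auto
      moreover have "b + d = n \<or> (b \<le> 1 \<or> n \<le> Suc b) \<and> (d \<le> 1 \<or> n \<le> Suc d)"
        using max_1_min_minus_eqD[OF eqs(2)] 2 bd \<open>b < d\<close> by (simp add: path_dist_0)
      ultimately show False
        using assms(1) bd \<open>b < d\<close> by auto
    qed
  qed
  from this[of b d] this[of d b] show ?thesis
    using assms(2,3,5,6) by (metis linorder_less_linear)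
qed

section \<open>The metric generator and the bound\<close>

lemma metric_generator_path_strong_product_cycle:
  assumes "4 \<le> n" "2 * (n div 2) < m"
  shows "metric_generator (path_graph m \<boxtimes> cycle_graph n) ((\<lambda>i. (i, i mod 2)) ` {..<m})"
    (is "metric_generator ?G ?S")
proof -
  have V: "pverts ?G = {..<m} \<times> {..<n}"
    by (simp add: strong_product_def path_graph_def cycle_graph_def)
  let ?D = "\<lambda>i a b. max (path_dist i a) (cycle_dist n (i mod 2) b)"
  have bound: "cycle_dist n i j \<le> n div 2" for i j by (rule cycle_dist_le)
  have rows: "\<exists>i<m. ?D i a b \<noteq> ?D i c d" if "a < c" "c < m" for a b c d
  proof (cases "n div 2 < c")
    case True
    \<comment> \<open>Both \<open>a\<close> and every cycle distance are smaller than
      \<open>c\<close>.\<close>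
    have "?D 0 a b < ?D 0 c d"
      using True that bound[of 0 b] by (auto simp: path_dist_def)
    then show ?thesis using that by (metis less_nat_zero_code nat_neq_iff neq0_conv)
  next
    case False
    \<comment> \<open>Here \<open>a < c\<close> and \<open>c\<close> is at most
      \<open>n div 2\<close>, so the distance \<open>m - 1 - a\<close> from the last row exceeds
      \<open>m - 1 - n div 2\<close>, which is at least \<open>n div 2\<close>.\<close>
    have "path_dist (m - 1) c < path_dist (m - 1) a" "n div 2 < path_dist (m - 1) a"
      using False that assms(2) by (auto simp: path_dist_def)
    then have "?D (m - 1) c d < ?D (m - 1) a b"
      using bound[of "(m - 1) mod 2" d] by (simp add: less_max_iff_disj)
    moreover have "m - 1 < m" using that by simp
    ultimately show ?thesis by (metis less_irrefl)
  qed
  have columns: "\<exists>i<m. ?D i a b \<noteq> ?D i a d" if "a < m" "b < n" "d < n" "b \<noteq> d" for a b d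
  proof -
    \<comment> \<open>A neighbouring row: the one below, or row 1 when \<open>a\<close> is 0.
      Adjacent rows have opposite parity, so the two landmarks have second coordinates 0 and 1 in
      some order.\<close>
    define a' where "a' = (if a = 0 then 1 else a - 1)"
    have a': "a' < m" "path_dist a' a = 1"
      using assms that(1) by (auto simp: a'_def path_dist_def)
    have "a' mod 2 = 1 - a mod 2"
      by (cases a) (simp_all add: a'_def mod_Suc)
    then have parity: "{a mod 2, a' mod 2} = {0, 1}"
      by (cases "a mod 2 = 0") auto
    \<comment> \<open>From its own row the landmark sees the cycle distance exactly, since the path
      distance is 0; from row \<open>a'\<close> it sees the cycle distance truncated at 1.\<close>
    have "?D a a b \<noteq> ?D a a d \<or> ?D a' a b \<noteq> ?D a' a d"
      using cycle_dist_resolves[OF assms(1) that(2,3) parity] that(4) a'(2)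
      by (auto simp: path_dist_def)
    then show ?thesis using that(1) a'(1) by blast
  qed
  have D: "\<exists>i<m. ?D i a b \<noteq> ?D i c d"
    if "a < m" "b < n" "c < m" "d < n" "(a, b) \<noteq> (c, d)" for a b c d
  proof (cases a c rule: linorder_cases)
    case less
    then show ?thesis using rows that by blast
  next
    case equal
    then show ?thesis using columns that by blast
  next
    case greater
    then obtain i where "i < m" "?D i c d \<noteq> ?D i a b" using rows \<open>a < m\<close> by blast
    then show ?thesis by (intro exI[of _ i]) simp
  qed
  have mod2: "i mod 2 < n" for i
    using assms(1) mod_less_divisor[of 2 i] by linarith
  have "\<exists>s \<in> ?S. graph_dist ?G s (a, b) \<noteq> graph_dist ?G s (c, d)"
    if *: "a < m" "b < n" "c < m" "d < n" "(a, b) \<noteq> (c, d)" for a b c d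
  proof -
    obtain i where i: "i < m" "?D i a b \<noteq> ?D i c d" using D[OF *] by blast
    then have "graph_dist ?G (i, i mod 2) (a, b) \<noteq> graph_dist ?G (i, i mod 2) (c, d)"
      unfolding graph_dist_path_strong_product_cycle[OF i(1) mod2 *(1,2)]
        graph_dist_path_strong_product_cycle[OF i(1) mod2 *(3,4)]
      by (simp only: ereal.inject of_nat_eq_iff not_False_eq_True)
    then show ?thesis using i(1) by blast
  qed
  moreover have "?S \<subseteq> pverts ?G" using mod2 V by auto
  ultimately show ?thesis
    unfolding metric_generator_def V by blast
qed

lemma metric_dim_le:
  assumes "finite S" "metric_generator G S"
  shows "metric_dim G \<le> card S"
  unfolding metric_dim_def by (rule Least_le) (use assms in blast)

theorem theorem7:
  fixes n1 n2 :: nat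
  assumes "(real n1 - 1) / 2 \<ge> real_of_int \<lfloor>real n2 / 2\<rfloor>"
    and "\<lfloor>real n2 / 2\<rfloor> \<ge> 2"
  shows "metric_dim (path_graph n1 \<boxtimes> cycle_graph n2) \<le> n1"
proof -
  \<comment> \<open>Turning the real floor into \<open>n2 div 2\<close> reduces both assumptions to
    linear arithmetic on natural numbers.\<close>
  have h: "\<lfloor>real n2 / 2\<rfloor> = int (n2 div 2)"
    using floor_divide_of_nat_eq[of n2 2] by simp
  have "4 \<le> n2" "2 * (n2 div 2) < n1"
    using assms unfolding h by simp_all
  then have "metric_dim (path_graph n1 \<boxtimes> cycle_graph n2) \<le>
      card ((\<lambda>i. (i, i mod 2 :: nat)) ` {..<n1})"
    by (intro metric_dim_le metric_generator_path_strong_product_cycle) auto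
  also have "\<dots> \<le> n1"
    using card_image_le[of "{..<n1}" "\<lambda>i. (i, i mod 2 :: nat)"] by simp
  finally show ?thesis .
qed

end
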